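(* Let $\Sigma,\Gamma$ be finite alphabets, each with at least two letters. For every infinite word $w\in\Sigma^{\mathbb{N}}$, $$\mathrm{ACE}_{\mathcal{I}}(w) \le (|\Sigma|+1) + |\Sigma|(|\Sigma|+1)\big(\lfloor \mathrm{ACE}(w)\rfloor + 1\big).$$
   Context: $\mathrm{Fact}_n(w)$ is the set of length-$n$ factors of $w$. For a nonempty word $v$ and integer $p\ge0$, $v^{p/|v|}$ is the prefix of length $p$ of $vvv\cdots$. For a nonempty finite word $u$, $\mathrm{E}(u) = \sup\{ r \in \mathbb{Q} : u = v^r \text{ for some nonempty } v\}$. For an infinite word $w$, $\mathrm{ACE}(w) = \limsup_{n\to\infty}\sup\{\mathrm{E}(u) : u\in\mathrm{Fact}_n(w)\}$. $\mathcal{I}$ is the set of injective morphisms $\Sigma^*\to\Gamma^*$ and $\mathrm{ACE}_{\mathcal{I}}(w) = \sup\{\mathrm{ACE}(h(w)) : h\in\mathcal{I}\}$. (If $\mathrm{ACE}(w)=\infty$ the right-hand side is $\infty$.) *)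

theory Defs
  imports "HOL-Analysis.Analysis" "HOL-Library.Liminf_Limsup"
begin

definition Fact :: "nat \<Rightarrow> (nat \<Rightarrow> 'a) \<Rightarrow> 'a list set" where
  "Fact n w = {map (\<lambda>j. w (i + j)) [0..<n] | i. True}"

text \<open>v^(p/|v|): prefix of length p of vvv...\<close>
definition frac_pow :: "'a list \<Rightarrow> nat \<Rightarrow> 'a list" where
  "frac_pow v p = map (\<lambda>j. v ! (j mod length v)) [0..<p]"

text \<open>E(u) = sup { r rational : u = v^r, v nonempty }.  u = v^r forces r = |u|/|v|.\<close>
definition Exp :: "'a list \<Rightarrow> ereal" where
  "Exp u = Sup {ereal r | r v. v \<noteq> [] \<and> r \<in> \<rat> \<and> r * real (length v) = real (length u)
                               \<and> u = frac_pow v (length u)}"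

definition ACE :: "(nat \<Rightarrow> 'a) \<Rightarrow> ereal" where
  "ACE w = limsup (\<lambda>n. SUP u \<in> Fact n w. Exp u)"

definition morph :: "('a \<Rightarrow> 'b list) \<Rightarrow> 'a list \<Rightarrow> 'b list" where
  "morph h u = concat (map h u)"

definition inj_morphisms :: "('a \<Rightarrow> 'b list) set" where
  "inj_morphisms = {h. inj (morph h)}"

text \<open>Image h(w) of an infinite word (well defined when every h a is nonempty,
  which holds for injective morphisms): letter k of h(w) is letter k of
  h(w 0 ... w k).\<close>
definition morph_inf :: "('a \<Rightarrow> 'b list) \<Rightarrow> (nat \<Rightarrow> 'a) \<Rightarrow> (nat \<Rightarrow> 'b)" where
  "morph_inf h w k = morph h (map w [0..<Suc k]) ! k"

definition ACE_I :: "'b itself \<Rightarrow> (nat \<Rightarrow> 'a) \<Rightarrow> ereal" where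
  "ACE_I _ w = (SUP h \<in> (inj_morphisms :: ('a \<Rightarrow> 'b list) set). ACE (morph_inf h w))"

end

theory Submission
  imports Defs "HOL-Library.List_Lexorder"
begin

text \<open>
  Let \<open>u\<close> be a long factor of \<open>h(w)\<close> with least period \<open>p\<close>, let \<open>k = |\<Sigma>|\<close> and
  \<open>B = \<lfloor>ACE(w)\<rfloor> + 1\<close>. Call the ends of the images of letters cuts. The stretch of \<open>w\<close> between
  two cuts congruent modulo \<open>p\<close> has as image a power of a conjugate of the repeated block, so
  for a fixed residue all these stretches commute by injectivity of \<open>h\<close>. Thus
  \<open>m + 1\<close> congruent cuts yield a factor of \<open>w\<close> of exponent at least \<open>m\<close>, and \<open>m < B\<close> if this
  factor is long. If \<open>p\<close> is bounded, the pigeonhole principle on residues bounds \<open>|u|\<close>.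
  If \<open>p\<close> exceeds all \<open>|h(a)|\<close>, let \<open>y\<close> be the start of a lexicographically least conjugate of
  the repeated block. That conjugate is unbordered, so for each letter \<open>a\<close> all occurrences of
  \<open>h(a)\<close> across the points \<open>y + jp\<close> cover them at the same offset. By the pigeonhole principle on
  letters, \<open>kB + 1\<close> such points produce \<open>B + 1\<close> congruent cuts, a contradiction. Hence the
  exponent of \<open>u\<close> is at most \<open>kB + 3\<close>.
\<close>

section \<open>Unbordered conjugates of finite words\<close>

text \<open>Take the lexicographically least rotation \<open>l\<close>. A border \<open>s\<close>
  gives \<open>l = s @ x = y @ s\<close>; the rotations \<open>x @ s\<close> and
  \<open>s @ y\<close> are not smaller than \<open>l\<close>, which forces \<open>x = y\<close>, so
  rotation by \<open>length s\<close> fixes \<open>l\<close>. Allowing this outcome covers words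
  that are proper powers.\<close>

lemma unbordered_rotation_nat:
  fixes v :: "nat list"
  assumes "v \<noteq> []"
  shows "\<exists>i<length v. \<forall>q. 0 < q \<and> q < length v \<and>
           take q (rotate i v) = drop (length v - q) (rotate i v) \<longrightarrow>
           rotate q (rotate i v) = rotate i v"
proof -
  define R where "R = (\<lambda>i. rotate i v) ` {..<length v}"
  have R: "finite R" "R \<noteq> {}" using assms by (auto simp: R_def)
  obtain i where i: "i < length v" "Min R = rotate i v"
    using Min_in[OF R] by (auto simp: R_def)
  have rot: "rotate j v \<in> R" for j
    using assms by (subst rotate_conv_mod) (auto simp: R_def)
  have le: "rotate i v \<le> rotate j (rotate i v)" for j
    using Min_le[OF R(1) rot[of "j + i"]] i(2) by (simp add: rotate_rotate)
  have "rotate q (rotate i v) = rotate i v"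
    if q: "0 < q" "q < length v" "take q (rotate i v) = drop (length v - q) (rotate i v)" for q
  proof -
    define l where "l = rotate i v"
    define s x y where "s = take q l" and "x = drop q l" and "y = take (length v - q) l"
    have len: "length l = length v" by (simp add: l_def)
    have s': "s = drop (length v - q) l" using q(3) by (simp add: s_def l_def)
    have l: "l = s @ x" "l = y @ s"
      by (simp add: s_def x_def) (simp add: s' y_def)
    have lens: "length s = q" "length y = length v - q" "length x = length y"
      using q len by (auto simp: s_def y_def x_def)
    have "rotate q l = x @ s"
      using rotate_append[of s x] l(1) lens(1) by metis
    moreover have "rotate (length v - q) l = s @ y"
      using rotate_append[of y s] l(2) lens(2) by metis
    ultimately have 1: "y @ s \<le> x @ s" and 2: "s @ x \<le> s @ y"
      using le[of q] le[of "length v - q"] l by (simp_all add: l_def)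
    \<comment> \<open>Cancelling the common suffix is sound because \<open>x\<close> and
      \<open>y\<close> have equal length.\<close>
    have "y \<le> x" using 1 lens(3)
      by (auto simp: list_le_def list_less_def lexord_append_left_rightI lexord_sufE)
    moreover have "x \<le> y" using 2
      by (auto simp: list_le_def list_less_def lexord_same_pref_iff)
    ultimately have "x = y" by simp
    then show ?thesis using \<open>rotate q l = x @ s\<close> l by (simp add: l_def)
  qed
  then show ?thesis using i(1) by blast
qed

text \<open>An injection of the letters into \<open>nat\<close> supplies the linear order; the claim
  speaks only of equality of words, so it transfers back.\<close>

lemma unbordered_rotation:
  fixes v :: "'b::countable list"
  assumes "v \<noteq> []"
  shows "\<exists>i<length v. \<forall>q. 0 < q \<and> q < length v \<and>
           take q (rotate i v) = drop (length v - q) (rotate i v) \<longrightarrow>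
           rotate q (rotate i v) = rotate i v"
proof -
  have inj: "map to_nat xs = map to_nat ys \<longleftrightarrow> xs = ys" for xs ys :: "'b list"
    by (simp add: inj_map_eq_map)
  show ?thesis
    using unbordered_rotation_nat[of "map to_nat v"] assms
    by (simp add: rotate_map take_map drop_map inj)
qed

section \<open>Periods of a window in an infinite word\<close>

definition periodic_on :: "(nat \<Rightarrow> 'b) \<Rightarrow> nat \<Rightarrow> nat \<Rightarrow> nat \<Rightarrow> bool" where
  "periodic_on f s n p \<longleftrightarrow> 0 < p \<and> (\<forall>x\<ge>s. x + p < s + n \<longrightarrow> f x = f (x + p))"

lemma periodic_on_add_mult:
  assumes "periodic_on f s n p" "s \<le> x" "x + k * p < s + n"
  shows "f (x + k * p) = f x"
  using assms(3)
proof (induction k)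
  case (Suc k)
  then have "f (x + k * p) = f x" by simp
  moreover have "f (x + k * p) = f (x + k * p + p)"
    using assms(1,2) Suc.prems by (auto simp: periodic_on_def algebra_simps)
  ultimately show ?case by (simp add: algebra_simps)
qed simp

lemma periodic_on_cong:
  assumes per: "periodic_on f s n p"
    and "s \<le> x" "x < s + n" "s \<le> y" "y < s + n" "x mod p = y mod p"
  shows "f x = f y"
proof -
  have *: "f b = f a"
    if ab: "a \<le> b" "s \<le> a" "b < s + n" "a mod p = b mod p" for a b
  proof -
    obtain k where "b = a + p * k"
      using mod_eq_nat1E[OF ab(4)[symmetric] ab(1)] by blast
    then show ?thesis using periodic_on_add_mult[OF per, of a k] ab by (simp add: mult.commute)
  qed
  show ?thesis
    using *[of x y] *[of y x] assms(2-) by (metis nat_le_linear)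
qed

lemma periodic_on_frac_pow:
  assumes "map (\<lambda>j. f (s + j)) [0..<n] = frac_pow v n" "v \<noteq> []"
  shows "periodic_on f s n (length v)"
  unfolding periodic_on_def
proof (intro conjI allI impI)
  have val: "f (s + j) = v ! (j mod length v)" if "j < n" for j
    using that arg_cong[OF assms(1), of "\<lambda>l. l ! j"] by (simp add: frac_pow_def)
  fix x assume x: "s \<le> x" "x + length v < s + n"
  obtain j where j: "x = s + j" using x(1) by (auto simp: le_iff_add)
  then show "f x = f (x + length v)"
    using val[of j] val[of "j + length v"] x(2) by (simp add: add.assoc)
qed (use assms in simp)

text \<open>What is excluded is a square of half-length \<open>q\<close> centred at
  \<open>y\<close>. Shifting its left half by \<open>p\<close> turns it into a border of the chosen
  rotation of the block at \<open>t\<close>; then rotation by \<open>q\<close> fixes that block, and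
  \<open>q\<close> is a period of the whole window, contrary to the minimality of
  \<open>p\<close>.\<close>

lemma exists_unbordered_position:
  fixes f :: "nat \<Rightarrow> 'b::countable"
  assumes per: "periodic_on f s n p"
    and minimal: "\<And>q. periodic_on f s n q \<Longrightarrow> p \<le> q"
    and t: "s \<le> t" "t + 2 * p \<le> s + n"
  shows "\<exists>y. t \<le> y \<and> y < t + p \<and>
           (\<forall>q. 0 < q \<and> q < p \<and> s + q \<le> y \<longrightarrow> (\<exists>m<q. f (y - q + m) \<noteq> f (y + m)))"
proof -
  have p: "0 < p" using per by (simp add: periodic_on_def)
  define v where "v = map f [t..<t + p]"
  have lv: "length v = p" "v \<noteq> []" using p by (auto simp: v_def)
  obtain i where i: "i < p"
    and unb: "\<And>q. 0 < q \<Longrightarrow> q < p \<Longrightarrow> take q (rotate i v) = drop (p - q) (rotate i v) \<Longrightarrow>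
           rotate q (rotate i v) = rotate i v"
    using unbordered_rotation[OF lv(2)] unfolding lv(1) by blast
  define y where "y = t + i"
  have l: "rotate i v ! j = f (y + j)" if "j < p" for j
  proof -
    have "rotate i v ! j = f (t + (i + j) mod p)"
      using that p by (simp add: nth_rotate lv v_def)
    also have "\<dots> = f (y + j)"
    proof (rule periodic_on_cong[OF per])
      have "(i + j) mod p < p" using p by simp
      then show "t + (i + j) mod p < s + n" using t by linarith
      show "(t + (i + j) mod p) mod p = (y + j) mod p"
        by (simp add: y_def mod_simps add.assoc)
    qed (use t i that in \<open>auto simp: y_def\<close>)
    finally show ?thesis .
  qed
  have "\<exists>m<q. f (y - q + m) \<noteq> f (y + m)" if q: "0 < q" "q < p" "s + q \<le> y" for q
  proof (rule ccontr)
    assume "\<not> ?thesis"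
    then have eq: "f (y - q + m) = f (y + m)" if "m < q" for m using that by blast
    have "take q (rotate i v) = drop (p - q) (rotate i v)"
    proof (rule nth_equalityI)
      fix m assume "m < length (take q (rotate i v))"
      then have m: "m < q" by (simp add: lv)
      have "take q (rotate i v) ! m = f (y - q + m)"
        using m q l[of m] eq[of m] by simp
      also have "\<dots> = f (y - q + m + 1 * p)"
        using periodic_on_add_mult[OF per, of "y - q + m" 1] q m t i by (simp add: y_def)
      also have "\<dots> = drop (p - q) (rotate i v) ! m"
        using m q l[of "p - q + m"] by (simp add: lv add_ac)
      finally show "take q (rotate i v) ! m = drop (p - q) (rotate i v) ! m" .
    qed (use q in \<open>simp add: lv\<close>)
    then have rot: "rotate q (rotate i v) = rotate i v" using unb q by blast
    have step: "f (y + j) = f (y + (q + j) mod p)" if "j < p" for j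
    proof -
      have "rotate i v ! j = rotate i v ! ((q + j) mod p)"
        using that by (subst rot[symmetric], subst nth_rotate) (simp_all add: lv)
      then show ?thesis using l that p by simp
    qed
    have "periodic_on f s n q"
      unfolding periodic_on_def
    proof (intro conjI allI impI)
      fix x assume x: "s \<le> x" "x + q < s + n"
      \<comment> \<open>The index with \<open>y + j\<close> congruent to \<open>x\<close>; adding
        \<open>p * y\<close> keeps the subtraction from truncating.\<close>
      define j where "j = (x + p * y - y) mod p"
      have "y \<le> p * y" using p by (cases p) simp_all
      then have "y + (x + p * y - y) = x + p * y" by linarith
      then have cong: "(y + j) mod p = x mod p"
        by (metis j_def mod_add_right_eq mod_mult_self2)
      have j: "j < p" using p by (simp add: j_def)
      have qj: "(q + j) mod p < p" using p by simp
      have "f x = f (y + j)"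
        using periodic_on_cong[OF per, of x "y + j"] x j t i cong by (simp add: y_def)
      also have "\<dots> = f (y + (q + j) mod p)" using step[OF j] .
      also have "\<dots> = f (x + q)"
      proof (rule periodic_on_cong[OF per])
        have "(y + (q + j) mod p) mod p = ((y + j) mod p + q) mod p"
          by (simp add: mod_simps add_ac)
        then show "(y + (q + j) mod p) mod p = (x + q) mod p"
          unfolding cong by (simp add: mod_simps)
        show "y + (q + j) mod p < s + n" using qj t i unfolding y_def by linarith
      qed (use x t in \<open>auto simp: y_def\<close>)
      finally show "f x = f (x + q)" .
    qed (use q in simp)
    then show False using minimal[of q] q by simp
  qed
  then show ?thesis using i by (intro exI[of _ y]) (auto simp: y_def)
qed

section \<open>Commuting words and counting\<close>

text \<open>Beyond the first \<open>length z\<close> letters, commutation gives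
  \<open>u ! j = u ! (j - length z)\<close>; strong induction descends to the letters of
  \<open>z\<close>.\<close>

lemma frac_pow_of_commute:
  assumes "z @ u = u @ z" "z \<noteq> []"
  shows "u = frac_pow z (length u)"
proof (rule nth_equalityI)
  fix j assume "j < length u"
  then show "u ! j = frac_pow z (length u) ! j"
  proof (induction j rule: less_induct)
    case (less j)
    have eq: "u ! j = (z @ u) ! j" using less.prems assms(1) by (simp add: nth_append)
    show ?case
    proof (cases "j < length z")
      case True
      then show ?thesis using eq less.prems by (simp add: nth_append frac_pow_def)
    next
      case False
      then have "u ! j = u ! (j - length z)" using eq by (simp add: nth_append)
      also have "\<dots> = z ! ((j - length z) mod length z)"
        using less.IH[of "j - length z"] less.prems False assms(2)
        by (cases z) (simp_all add: frac_pow_def)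
      also have "\<dots> = z ! (j mod length z)" using False by (simp add: le_mod_geq)
      finally show ?thesis using less.prems by (simp add: frac_pow_def)
    qed
  qed
qed (simp add: frac_pow_def)

text \<open>Divide the line from \<open>Min C\<close> on into slots of length \<open>g\<close>; the
  gap condition puts at most one element into each slot.\<close>

lemma card_le_of_gaps:
  fixes C :: "nat set"
  assumes C: "finite C" "C \<noteq> {}" and gap: "\<And>a b. a \<in> C \<Longrightarrow> b \<in> C \<Longrightarrow> a < b \<Longrightarrow> g \<le> b - a"
    and "0 < g"
  shows "(card C - 1) * g \<le> Max C - Min C"
proof -
  define \<phi> where "\<phi> x = (x - Min C) div g" for x
  have less: "\<phi> a < \<phi> b" if "a \<in> C" "b \<in> C" "a < b" for a b
  proof -
    have "a - Min C + g \<le> b - Min C" using gap[OF that] that(3) Min_le[OF C(1) that(1)] by linarith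
    then have "(a - Min C + g) div g \<le> \<phi> b" unfolding \<phi>_def by (rule div_le_mono)
    then show ?thesis using \<open>0 < g\<close> by (simp add: \<phi>_def)
  qed
  have "inj_on \<phi> C"
  proof (rule inj_onI, rule ccontr)
    fix a b assume "a \<in> C" "b \<in> C" "\<phi> a = \<phi> b" "a \<noteq> b"
    then show False using less[of a b] less[of b a] by (cases "a < b") auto
  qed
  moreover have "\<phi> ` C \<subseteq> {..(Max C - Min C) div g}"
    using C by (auto simp: \<phi>_def intro!: div_le_mono diff_le_mono)
  ultimately have "card C \<le> card {..(Max C - Min C) div g}"
    by (rule card_inj_on_le) simp
  then have "(card C - 1) * g \<le> (Max C - Min C) div g * g" by (intro mult_le_mono1) simp
  then show ?thesis using div_times_less_eq_dividend order_trans by blast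
qed

lemma pigeonhole_fibre:
  assumes "finite A" "finite R" "f ` A \<subseteq> R" "card R * m < card A"
  shows "\<exists>r\<in>R. m < card {x \<in> A. f x = r}"
proof (rule ccontr)
  assume "\<not> ?thesis"
  then have le: "card {x \<in> A. f x = r} \<le> m" if "r \<in> R" for r using that by auto
  have "A = (\<Union>r\<in>R. {x \<in> A. f x = r})" using assms(3) by auto
  then have "card A \<le> (\<Sum>r\<in>R. card {x \<in> A. f x = r})"
    using card_UN_le[OF assms(2)] by metis
  also have "\<dots> \<le> card R * m" using sum_bounded_above[OF le] by simp
  finally show False using assms(4) by simp
qed

section \<open>Cuts in the image of an infinite word and powers between them\<close>

lemma morph_append: "morph h (u @ v) = morph h u @ morph h v"
  by (simp add: morph_def)

definition cut_pos :: "('a \<Rightarrow> 'b list) \<Rightarrow> (nat \<Rightarrow> 'a) \<Rightarrow> nat \<Rightarrow> nat" where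
  "cut_pos h w i = length (morph h (map w [0..<i]))"

lemma cut_pos_0 [simp]: "cut_pos h w 0 = 0"
  by (simp add: cut_pos_def morph_def)

lemma cut_pos_Suc: "cut_pos h w (Suc i) = cut_pos h w i + length (h (w i))"
  by (simp add: cut_pos_def morph_def)

lemma cut_pos_add_le:
  assumes "\<And>a. length (h a) \<le> P"
  shows "cut_pos h w (i + j) \<le> cut_pos h w i + j * P"
proof (induction j)
  case (Suc j)
  then show ?case using assms[of "w (i + j)"] by (simp add: cut_pos_Suc)
qed simp

locale injective_morphism =
  fixes h :: "'a::finite \<Rightarrow> 'b::countable list" and w :: "nat \<Rightarrow> 'a"
  assumes inj: "inj (morph h)"
begin

lemma image_nonempty: "h a \<noteq> []"
proof
  assume "h a = []"
  then have "morph h [a] = morph h []" by (simp add: morph_def)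
  then show False using inj by (auto dest: injD)
qed

lemma strict_mono_cut_pos: "strict_mono (cut_pos h w)"
  by (rule strict_monoI_Suc) (simp add: cut_pos_Suc image_nonempty)

lemma le_cut_pos: "i \<le> cut_pos h w i"
  using strict_mono_cut_pos by (rule strict_mono_imp_increasing)

text \<open>Images of prefixes are prefixes of one another, so letter \<open>k\<close> can be read
  off any prefix with a long enough image, not only the one of length \<open>Suc k\<close> in the
  definition.\<close>

lemma morph_inf_nth:
  assumes "k < cut_pos h w i"
  shows "morph_inf h w k = morph h (map w [0..<i]) ! k"
proof -
  have prefix: "morph h (map w [0..<j]) ! k = morph h (map w [0..<i]) ! k"
    if "i \<le> j" "k < cut_pos h w i" for i j
  proof -
    have "[0..<j] = [0..<i] @ [i..<j]" using that upt_add_eq_append[of 0 i "j - i"] by simp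
    then show ?thesis using that by (simp add: morph_append nth_append cut_pos_def)
  qed
  have "k < cut_pos h w (Suc k)" using le_cut_pos[of "Suc k"] by simp
  then show ?thesis unfolding morph_inf_def
    using prefix[of i "Suc k"] prefix[of "Suc k" i] assms by (cases "i \<le> Suc k") auto
qed

lemma morph_inf_cut_pos_add:
  assumes "d < length (h (w i))"
  shows "morph_inf h w (cut_pos h w i + d) = h (w i) ! d"
proof -
  have "morph_inf h w (cut_pos h w i + d) = morph h (map w [0..<Suc i]) ! (cut_pos h w i + d)"
    using assms by (intro morph_inf_nth) (simp add: cut_pos_Suc)
  also have "\<dots> = h (w i) ! d" by (simp add: morph_append nth_append cut_pos_def) (simp add: morph_def)
  finally show ?thesis .
qed

lemma morph_factor:
  assumes "i \<le> j"
  shows "morph h (map w [i..<j]) = map (morph_inf h w) [cut_pos h w i..<cut_pos h w j]"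
proof -
  have prefix: "morph h (map w [0..<j]) = map (morph_inf h w) [0..<cut_pos h w j]" for j
    by (rule nth_equalityI) (simp_all add: morph_inf_nth cut_pos_def[symmetric])
  have "cut_pos h w i \<le> cut_pos h w j"
    using assms strict_mono_less_eq[OF strict_mono_cut_pos] by blast
  then have split_cut: "[0..<cut_pos h w j] = [0..<cut_pos h w i] @ [cut_pos h w i..<cut_pos h w j]"
    using upt_add_eq_append[of 0 "cut_pos h w i" "cut_pos h w j - cut_pos h w i"] by simp
  have "[0..<j] = [0..<i] @ [i..<j]"
    using assms upt_add_eq_append[of 0 i "j - i"] by simp
  then have "morph h (map w [0..<i]) @ morph h (map w [i..<j]) =
      map (morph_inf h w) [0..<cut_pos h w j]"
    by (simp only: prefix[of j, symmetric] map_append morph_append)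
  then show ?thesis by (simp only: split_cut prefix map_append same_append_eq)
qed

text \<open>The root \<open>z\<close> is the factor between two cuts in \<open>C\<close> at minimal distance.\<close>

lemma power_between_congruent_cuts:
  assumes per: "periodic_on (morph_inf h w) s n p"
    and C: "finite C" "2 \<le> card C"
    and range: "\<And>c. c \<in> C \<Longrightarrow> s \<le> cut_pos h w c \<and> cut_pos h w c \<le> s + n"
    and cong: "\<And>c c'. c \<in> C \<Longrightarrow> c' \<in> C \<Longrightarrow> cut_pos h w c mod p = cut_pos h w c' mod p"
  shows "\<exists>z. z \<noteq> [] \<and> (card C - 1) * length z \<le> Max C - Min C \<and>
           map w [Min C..<Max C] = frac_pow z (Max C - Min C)"
proof -
  let ?f = "morph_inf h w" and ?pos = "cut_pos h w"
  have p: "0 < p" using per by (simp add: periodic_on_def)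
  have ne: "C \<noteq> {}" using C by auto
  define D where "D = {b - a |a b. a \<in> C \<and> b \<in> C \<and> a < b}"
  obtain a0 b0 where "a0 \<in> C" "b0 \<in> C" "a0 \<noteq> b0"
    using C card_le_Suc0_iff_eq[OF C(1)] by fastforce
  then have "D \<noteq> {}" unfolding D_def by (cases a0 b0 rule: linorder_cases) auto
  define d where "d = (LEAST d. d \<in> D)"
  have d: "d \<in> D" "\<And>d'. d' \<in> D \<Longrightarrow> d \<le> d'"
    using \<open>D \<noteq> {}\<close> by (auto simp: d_def intro: LeastI Least_le)
  obtain a b where ab: "a \<in> C" "b \<in> C" "a < b" "d = b - a" using d(1) by (auto simp: D_def)
  have gaps: "(card C - 1) * (b - a) \<le> Max C - Min C"
    using ab d(2) by (intro card_le_of_gaps[OF C(1) ne]) (auto simp: D_def)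
  define c c' where "c = Min C" and "c' = Max C"
  have cc: "c \<in> C" "c' \<in> C" "c \<le> c'" using C ne by (auto simp: c_def c'_def)
  \<comment> \<open>The \<open>p\<close>-periodic word anchored at the leftmost cut. As all cuts in
    \<open>C\<close> share a residue, the image of each stretch between two of them is a prefix of
    \<open>F\<close>.\<close>
  define F where "F x = ?f (?pos c + x mod p)" for x
  have image: "morph h (map w [i..<j]) = map F [0..<?pos j - ?pos i]"
    if "i \<in> C" "j \<in> C" "i \<le> j" for i j
  proof -
    have le: "?pos i \<le> ?pos j" using that strict_mono_less_eq[OF strict_mono_cut_pos] by blast
    have "map ?f [?pos i..<?pos j] = map F [0..<?pos j - ?pos i]"
    proof (rule nth_equalityI)
      fix x assume "x < length (map ?f [?pos i..<?pos j])"
      then have x: "x < ?pos j - ?pos i" by simp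
      have "c \<le> i" using that C by (simp add: c_def)
      then have "?pos c \<le> ?pos i" using strict_mono_less_eq[OF strict_mono_cut_pos] by blast
      then have "?pos c + x mod p < s + n"
        using x range[OF that(2)] mod_less_eq_dividend[of x p] by linarith
      moreover have "(?pos i + x) mod p = (?pos c + x mod p) mod p"
        using cong[OF that(1) cc(1)] by (metis mod_add_left_eq mod_add_right_eq)
      ultimately have "?f (?pos i + x) = F x" unfolding F_def
        using range[OF that(1)] range[OF that(2)] range[OF cc(1)] x
        by (intro periodic_on_cong[OF per]) auto
      then show "map ?f [?pos i..<?pos j] ! x = map F [0..<?pos j - ?pos i] ! x"
        using x by simp
    qed simp
    then show ?thesis using morph_factor[OF that(3)] by simp
  qed
  \<comment> \<open>After a length divisible by \<open>p\<close> the word \<open>F\<close> starts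
    afresh, so such prefixes concatenate to prefixes.\<close>
  have glue: "map F [0..<l] @ map F [0..<m] = map F [0..<l + m]" if "p dvd l" for l m
  proof (rule nth_equalityI)
    fix x assume "x < length (map F [0..<l] @ map F [0..<m])"
    moreover have "(x - l) mod p = x mod p" if "l \<le> x"
      using \<open>p dvd l\<close> that by (auto simp: dvd_def le_iff_add)
    ultimately show "(map F [0..<l] @ map F [0..<m]) ! x = map F [0..<l + m] ! x"
      by (auto simp: nth_append F_def)
  qed simp
  have dvd: "p dvd ?pos j - ?pos i" if "i \<in> C" "j \<in> C" "i \<le> j" for i j
    using cong[OF that(2,1)] that(3) strict_mono_less_eq[OF strict_mono_cut_pos]
    by (metis mod_eq_dvd_iff_nat)
  define z u where "z = map w [a..<b]" and "u = map w [c..<c']"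
  \<comment> \<open>Both images are the prefix of \<open>F\<close> of the same total length;
    injectivity then makes \<open>z\<close> and \<open>u\<close> commute.\<close>
  have "morph h (z @ u) = morph h (u @ z)"
    using image[of a b] image[of c c'] dvd[of a b] dvd[of c c'] ab cc
    by (simp add: morph_append z_def u_def glue add.commute)
  then have "z @ u = u @ z" using inj by (auto dest: injD)
  moreover have "z \<noteq> []" using ab by (simp add: z_def)
  ultimately have "u = frac_pow z (length u)" by (intro frac_pow_of_commute)
  then show ?thesis
    using \<open>z \<noteq> []\<close> gaps by (intro exI[of _ z]) (simp add: u_def z_def c_def c'_def)
qed

text \<open>More than \<open>B\<close> cuts would make the stretch from the first to the last a
  power of exponent at least \<open>card C - 1\<close>, hence at least \<open>B\<close>, and its
  length is enough for \<open>pow\<close> to apply.\<close>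

lemma card_congruent_cuts_le:
  assumes pow: "\<And>i j z. i + N0 \<le> j \<Longrightarrow> z \<noteq> [] \<Longrightarrow> map w [i..<j] = frac_pow z (j - i) \<Longrightarrow>
                  j - i < B * length z"
    and B: "0 < B"
    and per: "periodic_on (morph_inf h w) s n p"
    and C: "finite C" "Min C + N0 \<le> Max C"
    and range: "\<And>c. c \<in> C \<Longrightarrow> s \<le> cut_pos h w c \<and> cut_pos h w c \<le> s + n"
    and cong: "\<And>c c'. c \<in> C \<Longrightarrow> c' \<in> C \<Longrightarrow> cut_pos h w c mod p = cut_pos h w c' mod p"
  shows "card C \<le> B"
proof (rule ccontr)
  assume "\<not> card C \<le> B"
  then have "2 \<le> card C" using B by simp
  then obtain z where z: "z \<noteq> []" "(card C - 1) * length z \<le> Max C - Min C"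
      "map w [Min C..<Max C] = frac_pow z (Max C - Min C)"
    using power_between_congruent_cuts[OF per C(1) _ range cong] by blast
  then have "(card C - 1) * length z < B * length z" using pow[OF C(2) z(1,3)] by linarith
  then have "card C - 1 < B" by simp
  then show False using \<open>\<not> card C \<le> B\<close> by linarith
qed

section \<open>Length bounds for periodic windows of the image\<close>

lemma exists_crossing_letter: "\<exists>i. cut_pos h w i \<le> x \<and> x < cut_pos h w (Suc i)"
proof -
  define j where "j = (LEAST j. x < cut_pos h w j)"
  have j: "x < cut_pos h w j"
    unfolding j_def using le_cut_pos[of "Suc x"]
    by (intro LeastI[of "\<lambda>j. x < cut_pos h w j" "Suc x"]) simp
  \<comment> \<open>The least index is not 0, since \<open>cut_pos h w 0 = 0\<close>.\<close>
  then obtain i where i: "j = Suc i" by (cases j) auto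
  then have "\<not> x < cut_pos h w i" using not_less_Least[of i "\<lambda>j. x < cut_pos h w j"] by (simp add: j_def)
  then show ?thesis using j i by (intro exI[of _ i]) simp
qed

text \<open>A longer window contains more than \<open>Q * (B + N0)\<close> consecutive cuts, at most
  \<open>P\<close> apart after an initial stretch of at most \<open>P\<close>. There are at most
  \<open>Q\<close> residues modulo \<open>p\<close>, so one of them has more than
  \<open>B + N0\<close> cuts. The summand \<open>N0\<close> makes these cuts span at least
  \<open>N0\<close> letters.\<close>

lemma repetition_bound_short_period:
  assumes pow: "\<And>i j z. i + N0 \<le> j \<Longrightarrow> z \<noteq> [] \<Longrightarrow> map w [i..<j] = frac_pow z (j - i) \<Longrightarrow>
                  j - i < B * length z"
    and B: "0 < B" and P: "\<And>a. length (h a) \<le> P"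
    and per: "periodic_on (morph_inf h w) s n p" and "p \<le> Q"
  shows "n < P + Q * (B + N0) * P"
proof (rule ccontr)
  assume "\<not> ?thesis"
  then have n: "P + Q * (B + N0) * P \<le> n" by simp
  have p: "0 < p" using per by (simp add: periodic_on_def)
  obtain i where i: "cut_pos h w i \<le> s" "s < cut_pos h w (Suc i)"
    using exists_crossing_letter by blast
  define A where "A = {Suc i..Suc i + Q * (B + N0)}"
  have range: "s \<le> cut_pos h w c \<and> cut_pos h w c \<le> s + n" if "c \<in> A" for c
  proof -
    obtain k where k: "c = Suc i + k" "k \<le> Q * (B + N0)"
      using \<open>c \<in> A\<close> by (auto simp: A_def le_iff_add)
    have "cut_pos h w (Suc i) \<le> cut_pos h w c"
      using strict_mono_less_eq[OF strict_mono_cut_pos] k(1) by simp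
    moreover have "cut_pos h w c \<le> cut_pos h w (Suc i) + k * P"
      using cut_pos_add_le[of h P w "Suc i" k] P k(1) by simp
    moreover have "k * P \<le> Q * (B + N0) * P" using k(2) by (rule mult_le_mono1)
    moreover have "cut_pos h w (Suc i) \<le> s + P" using i(1) P[of "w i"] by (simp add: cut_pos_Suc)
    ultimately show ?thesis using i(2) n by linarith
  qed
  have "card {..<p} * (B + N0) < card A"
    using mult_le_mono1[OF \<open>p \<le> Q\<close>, of "B + N0"]
    by (simp add: A_def less_Suc_eq_le del: mult_le_cancel2 mult_le_cancel1)
  then obtain r where r: "B + N0 < card {c \<in> A. cut_pos h w c mod p = r}"
    using pigeonhole_fibre[of A "{..<p}" "\<lambda>c. cut_pos h w c mod p" "B + N0"] p
    by (fastforce simp: A_def)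
  define C where "C = {c \<in> A. cut_pos h w c mod p = r}"
  have C: "finite C" "B + N0 < card C" using r by (simp_all add: C_def A_def)
  then have "C \<noteq> {}" by auto
  have "C \<subseteq> {Min C..Max C}" using C by auto
  then have "card C \<le> card {Min C..Max C}" by (intro card_mono) auto
  then have "Min C + N0 \<le> Max C" using C(2) B by simp
  then have "card C \<le> B"
    using range by (intro card_congruent_cuts_le[OF pow B per C(1)]) (auto simp: C_def)
  then show False using C(2) by simp
qed

text \<open>The threshold on \<open>p\<close> has two uses: \<open>P < p\<close> keeps differences
  of offsets in the range of the unbordered position, and \<open>N0 * P < p\<close> puts more than
  \<open>N0\<close> letters between distinct congruent cuts. Of the periods in the bound,
  \<open>CARD('a) * B\<close> carry the points \<open>y + j * p\<close>; the other three pay for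
  finding \<open>y\<close> and for margins of \<open>P\<close> at both ends.\<close>

lemma repetition_bound_long_period:
  assumes pow: "\<And>i j z. i + N0 \<le> j \<Longrightarrow> z \<noteq> [] \<Longrightarrow> map w [i..<j] = frac_pow z (j - i) \<Longrightarrow>
                  j - i < B * length z"
    and B: "0 < B" and P: "\<And>a. length (h a) \<le> P"
    and per: "periodic_on (morph_inf h w) s n p"
    and minimal: "\<And>q. periodic_on (morph_inf h w) s n q \<Longrightarrow> p \<le> q"
    and p: "P + N0 * P < p"
  shows "n < (CARD('a) * B + 3) * p"
proof (rule ccontr)
  let ?f = "morph_inf h w" and ?m = "CARD('a) * B"
  assume "\<not> ?thesis"
  then have n: "?m * p + 3 * p \<le> n" by (simp add: algebra_simps)
  have "P < p" using p by simp
  \<comment> \<open>Searching from \<open>s + P\<close> on leaves room in the window for the image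
    of a letter that crosses \<open>y\<close>.\<close>
  obtain y where y: "s + P \<le> y" "y < s + P + p"
    and unb: "\<And>q. 0 < q \<Longrightarrow> q < p \<Longrightarrow> s + q \<le> y \<Longrightarrow> \<exists>m<q. ?f (y - q + m) \<noteq> ?f (y + m)"
    using exists_unbordered_position[OF per minimal, of "s + P"] n \<open>P < p\<close> by auto
  have inside: "y + j * p + P < s + n" if "j \<le> ?m" for j
  proof -
    have "j * p \<le> ?m * p" using that by (rule mult_le_mono1)
    then show ?thesis using y n \<open>P < p\<close> by linarith
  qed
  have "\<exists>c. \<forall>j. cut_pos h w (c j) \<le> y + j * p \<and> y + j * p < cut_pos h w (Suc (c j))"
    by (intro choice allI exists_crossing_letter)
  then obtain c where c: "\<And>j. cut_pos h w (c j) \<le> y + j * p"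
      "\<And>j. y + j * p < cut_pos h w (Suc (c j))"
    by blast
  define d where "d j = y + j * p - cut_pos h w (c j)" for j
  have d: "y + j * p = cut_pos h w (c j) + d j" "d j < length (h (w (c j)))" "d j < P" for j
    using c(1)[of j] c(2)[of j] P[of "w (c j)"] by (auto simp: d_def cut_pos_Suc)
  \<comment> \<open>Moved back by \<open>j\<close> periods, the image crossing
    \<open>y + j * p\<close> reappears across \<open>y\<close> itself.\<close>
  have letter: "?f (y - d j + x) = h (w (c j)) ! x"
    if "j \<le> ?m" "x < length (h (w (c j)))" for j x
  proof -
    have "y - d j + x + j * p = cut_pos h w (c j) + x" using d(1)[of j] d(3)[of j] y by linarith
    moreover have "?f (y - d j + x + j * p) = ?f (y - d j + x)"
      using d(3)[of j] y inside[OF that(1)] that(2) P[of "w (c j)"]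
      by (intro periodic_on_add_mult[OF per]) linarith+
    ultimately show ?thesis using morph_inf_cut_pos_add[OF that(2)] by metis
  qed
  \<comment> \<open>Two copies of the same image laid across \<open>y\<close> at offsets differing
    by \<open>q\<close> would make the \<open>q\<close> letters before \<open>y\<close> repeat right
    after it.\<close>
  have offset: "\<not> d j < d j'" if "j \<le> ?m" "j' \<le> ?m" "w (c j) = w (c j')" for j j'
  proof
    assume less: "d j < d j'"
    define q where "q = d j' - d j"
    have q: "0 < q" "q < p" "s + q \<le> y" using less d(3)[of j'] \<open>P < p\<close> y by (auto simp: q_def)
    then obtain m where m: "m < q" "?f (y - q + m) \<noteq> ?f (y + m)" using unb by blast
    have x: "d j + m < length (h (w (c j)))" using m(1) d(2)[of j'] that(3) by (simp add: q_def)
    have "?f (y - d j' + (d j + m)) = ?f (y - d j + (d j + m))"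
      using letter[OF that(1) x] letter[OF that(2), of "d j + m"] x that(3) by simp
    moreover have "y - d j' + (d j + m) = y - q + m" "y - d j + (d j + m) = y + m"
      using less y d(3)[of j'] by (auto simp: q_def)
    ultimately show False using m(2) by simp
  qed
  \<comment> \<open>The set \<open>{..?m}\<close> has \<open>CARD('a) * B + 1\<close> elements, one
    too many for \<open>B\<close> points per letter.\<close>
  obtain a where a: "B < card {j \<in> {..?m}. w (c j) = a}"
    using pigeonhole_fibre[of "{..?m}" UNIV "\<lambda>j. w (c j)" B] by auto
  define J where "J = {j \<in> {..?m}. w (c j) = a}"
  have pos: "cut_pos h w (c j) = cut_pos h w (c j') + (j - j') * p"
    if "j \<in> J" "j' \<in> J" "j' \<le> j" for j j'
  proof -
    have "d j = d j'" using offset[of j j'] offset[of j' j] that by (auto simp: J_def)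
    moreover have "j * p = j' * p + (j - j') * p"
      using that(3) by (simp add: add_mult_distrib[symmetric])
    ultimately show ?thesis using d(1)[of j] d(1)[of j'] by linarith
  qed
  \<comment> \<open>Different points give different occurrences of the letter, so the number of
    points is also the number of cuts.\<close>
  have "c j \<noteq> c j'" if "j \<in> J" "j' \<in> J" "j' < j" for j j'
  proof -
    have "0 < (j - j') * p" using that(3) \<open>P < p\<close> by simp
    then show ?thesis using pos[OF that(1,2)] that(3) by auto
  qed
  then have inj: "inj_on c J" by (metis inj_onI linorder_neqE_nat)
  define C where "C = c ` J"
  have C: "finite C" "B < card C" using a card_image[OF inj] by (auto simp: C_def J_def)
  have cong: "cut_pos h w x mod p = cut_pos h w x' mod p" if x: "x \<in> C" "x' \<in> C" for x x'
  proof -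
    have *: "cut_pos h w (c j) mod p = cut_pos h w (c j') mod p"
      if "j \<in> J" "j' \<in> J" "j' \<le> j" for j j'
      unfolding pos[OF that] by (rule mod_mult_self1)
    obtain j j' where "j \<in> J" "j' \<in> J" "x = c j" "x' = c j'"
      using x by (auto simp: C_def)
    then show ?thesis using *[of j j'] *[of j' j] by (cases "j' \<le> j") simp_all
  qed
  have range: "s \<le> cut_pos h w x \<and> cut_pos h w x \<le> s + n" if "x \<in> C" for x
  proof -
    obtain j where "j \<le> ?m" "x = c j" using \<open>x \<in> C\<close> by (auto simp: C_def J_def)
    then show ?thesis using d(1)[of j] d(3)[of j] inside[of j] y by simp
  qed
  have MM: "Min C \<in> C" "Max C \<in> C" "Min C \<noteq> Max C"
  proof -
    have "C \<noteq> {}" using C by auto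
    then show "Min C \<in> C" "Max C \<in> C" using C by auto
    have "C \<subseteq> {Min C..Max C}" using C(1) by auto
    then have "card C \<le> card {Min C..Max C}" by (intro card_mono) auto
    then show "Min C \<noteq> Max C" using C B by auto
  qed
  then have "Min C < Max C" using C(1) by (meson Min_le le_neq_implies_less)
  then have lt: "cut_pos h w (Min C) < cut_pos h w (Max C)"
    using strict_mono_cut_pos by (simp add: strict_mono_less)
  then have "p dvd cut_pos h w (Max C) - cut_pos h w (Min C)"
    using cong[OF MM(2,1)] by (simp add: mod_eq_dvd_iff_nat)
  then have "p \<le> cut_pos h w (Max C) - cut_pos h w (Min C)"
    using lt by (intro dvd_imp_le) auto
  moreover have "cut_pos h w (Max C) \<le> cut_pos h w (Min C) + (Max C - Min C) * P"
    using cut_pos_add_le[of h P w "Min C" "Max C - Min C"] P \<open>Min C < Max C\<close> by simp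
  ultimately have "N0 * P < (Max C - Min C) * P" using p by linarith
  then have "Min C + N0 \<le> Max C" by (simp add: less_diff_conv)
  then have "card C \<le> B" by (intro card_congruent_cuts_le[OF pow B per C(1) _ range cong])
  then show False using C(2) by simp
qed

text \<open>The threshold \<open>Q\<close> separates the two regimes: for large \<open>n\<close> the
  short case is impossible, so the least period exceeds \<open>Q\<close>. A bound by the least
  period then holds for every period.\<close>

lemma repetition_bound:
  assumes pow: "\<And>i j z. i + N0 \<le> j \<Longrightarrow> z \<noteq> [] \<Longrightarrow> map w [i..<j] = frac_pow z (j - i) \<Longrightarrow>
                  j - i < B * length z"
    and B: "0 < B"
  shows "\<exists>N. \<forall>n\<ge>N. \<forall>s p. periodic_on (morph_inf h w) s n p \<longrightarrow> n \<le> (CARD('a) * B + 3) * p"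
proof -
  define P where "P = Max (range (\<lambda>a. length (h a)))"
  have P: "length (h a) \<le> P" for a by (simp add: P_def)
  define Q where "Q = P + N0 * P"
  have "n \<le> (CARD('a) * B + 3) * p"
    if n: "P + Q * (B + N0) * P \<le> n" and per: "periodic_on (morph_inf h w) s n p" for n s p
  proof -
    define p0 where "p0 = (LEAST p. periodic_on (morph_inf h w) s n p)"
    have p0: "periodic_on (morph_inf h w) s n p0" unfolding p0_def using per by (rule LeastI)
    have minimal: "p0 \<le> q" if "periodic_on (morph_inf h w) s n q" for q
      unfolding p0_def using that by (rule Least_le)
    have "\<not> p0 \<le> Q"
      using repetition_bound_short_period[OF pow B P p0] n by (meson not_le)
    then have "n < (CARD('a) * B + 3) * p0"
      using repetition_bound_long_period[OF pow B P p0 minimal] by (simp add: Q_def)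
    also have "\<dots> \<le> (CARD('a) * B + 3) * p" using minimal[OF per] by (intro mult_le_mono2)
    finally show ?thesis by simp
  qed
  then show ?thesis by blast
qed

end

section \<open>From repetitions to exponents\<close>

lemma Exp_frac_pow_ge:
  assumes "u = frac_pow v (length u)" "v \<noteq> []"
  shows "ereal (real (length u) / real (length v)) \<le> Exp u"
  unfolding Exp_def
proof (intro Sup_upper CollectI exI conjI)
  show "u = frac_pow v (length u)" by (fact assms(1))
  show "real (length u) / real (length v) * real (length v) = real (length u)"
    using assms(2) by simp
qed (use assms(2) in simp_all)

lemma Exp_nonneg: "0 \<le> Exp u"
proof (cases "u = []")
  case True
  \<comment> \<open>The empty word is a power of exponent 0 of any nonempty word, here of one
    arbitrary letter.\<close>
  then show ?thesis using Exp_frac_pow_ge[of u "[undefined]"] by (simp add: frac_pow_def zero_ereal_def)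
next
  case False
  have "u = frac_pow u (length u)" by (rule nth_equalityI) (simp_all add: frac_pow_def)
  then have "ereal (real (length u) / real (length u)) \<le> Exp u" using False by (rule Exp_frac_pow_ge)
  then have "1 \<le> Exp u" using False by (simp add: one_ereal_def)
  then show ?thesis by (rule order_trans[rotated]) simp
qed

lemma map_upt_in_Fact: "map w [i..<j] \<in> Fact (j - i) w"
proof -
  have "map w [i..<j] = map (\<lambda>k. w (i + k)) [0..<j - i]" by (rule nth_equalityI) simp_all
  then show ?thesis unfolding Fact_def by blast
qed

lemma ACE_nonneg: "0 \<le> ACE w"
  unfolding ACE_def
proof (rule le_Limsup)
  have "0 \<le> (SUP u\<in>Fact n w. Exp u)" for n
    using Exp_nonneg by (rule SUP_upper2[rotated]) (use map_upt_in_Fact[of w 0 n] in simp)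
  then show "\<forall>\<^sub>F n in sequentially. 0 \<le> (SUP u\<in>Fact n w. Exp u)" by simp
qed simp

text \<open>An integer \<open>B\<close> strictly above \<open>ACE w\<close> bounds the exponents of
  all long factors of \<open>w\<close>, which is the hypothesis \<open>pow\<close> of the repetition
  bound. Conversely, writing a factor of the image as a fractional power of \<open>v\<close> makes
  \<open>length v\<close> a period of its window.\<close>

lemma ACE_morph_inf_le:
  fixes w :: "nat \<Rightarrow> 'a::finite" and h :: "'a \<Rightarrow> 'b::countable list"
  assumes inj: "inj (morph h)" and ACE: "ACE w < ereal (real B)"
  shows "ACE (morph_inf h w) \<le> ereal (real (CARD('a) * B + 3))"
proof -
  interpret injective_morphism h w by unfold_locales (rule inj)
  have "(0::ereal) < ereal (real B)" using ACE_nonneg ACE by (rule le_less_trans)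
  then have B: "0 < B" by simp
  obtain N0 where N0: "\<And>n. N0 \<le> n \<Longrightarrow> (SUP u\<in>Fact n w. Exp u) < ereal (real B)"
    using Limsup_lessD[OF ACE[unfolded ACE_def]] by (auto simp: eventually_sequentially)
  have "j - i < B * length z"
    if ij: "i + N0 \<le> j" and z: "z \<noteq> []" "map w [i..<j] = frac_pow z (j - i)" for i j z
  proof -
    have "ereal (real (j - i) / real (length z)) \<le> Exp (map w [i..<j])"
      using Exp_frac_pow_ge[of "map w [i..<j]" z] z(1) by (simp flip: z(2))
    also have "\<dots> \<le> (SUP u\<in>Fact (j - i) w. Exp u)" by (rule SUP_upper) (rule map_upt_in_Fact)
    also have "\<dots> < ereal (real B)" using ij by (intro N0) simp
    finally have "real (j - i) < real B * real (length z)" using z(1) by (simp add: field_simps)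
    then show ?thesis by (metis of_nat_less_iff of_nat_mult)
  qed
  then obtain N where N: "\<And>n s p. N \<le> n \<Longrightarrow> periodic_on (morph_inf h w) s n p \<Longrightarrow>
      n \<le> (CARD('a) * B + 3) * p"
    using repetition_bound[OF _ B, of N0] by blast
  have "Exp u \<le> ereal (real (CARD('a) * B + 3))"
    if n: "N \<le> n" and u: "u \<in> Fact n (morph_inf h w)" for n u
    unfolding Exp_def
  proof (rule Sup_least, clarify)
    fix r v assume v: "v \<noteq> []" "r * real (length v) = real (length u)" "u = frac_pow v (length u)"
    obtain s where s: "u = map (\<lambda>j. morph_inf h w (s + j)) [0..<n]"
      using u by (auto simp: Fact_def)
    then have "map (\<lambda>j. morph_inf h w (s + j)) [0..<n] = frac_pow v n" using v(3) by simp
    then have "n \<le> (CARD('a) * B + 3) * length v"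
      using N[OF n] periodic_on_frac_pow v(1) by blast
    then have "real n \<le> real (CARD('a) * B + 3) * real (length v)"
      by (metis of_nat_le_iff of_nat_mult)
    then have "r * real (length v) \<le> real (CARD('a) * B + 3) * real (length v)"
      using v(2) s by simp
    then show "ereal r \<le> ereal (real (CARD('a) * B + 3))" using v(1) by simp
  qed
  then have "\<forall>\<^sub>F n in sequentially.
      (SUP u\<in>Fact n (morph_inf h w). Exp u) \<le> ereal (real (CARD('a) * B + 3))"
    by (intro eventually_sequentiallyI[of N] SUP_least)
  then show ?thesis unfolding ACE_def by (rule Limsup_bounded)
qed

theorem theorem22:
  fixes w :: "nat \<Rightarrow> 'a::finite"
  assumes "CARD('a) \<ge> 2" and "CARD('b::finite) \<ge> 2"
  shows "ACE_I TYPE('b) w \<le>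
    (if ACE w = \<infinity> then \<infinity>
     else ereal (real (CARD('a) + 1)
       + real (CARD('a) * (CARD('a) + 1)) * (of_int \<lfloor>real_of_ereal (ACE w)\<rfloor> + 1)))"
proof (cases "ACE w = \<infinity>")
  case False
  then obtain x where x: "ACE w = ereal x" "0 \<le> x"
    using ACE_nonneg[of w] by (cases "ACE w") auto
  \<comment> \<open>The least integer strictly above \<open>ACE w\<close>, as the strict inequality
    in \<open>pow\<close> demands.\<close>
  define B where "B = nat (\<lfloor>x\<rfloor> + 1)"
  have B: "real B = of_int \<lfloor>x\<rfloor> + 1" "1 \<le> B" using x(2) by (simp_all add: B_def nat_add_distrib)
  have "ACE w < ereal (real B)" using x B by (simp add: floor_less_iff)
  then have le: "ACE (morph_inf h w) \<le> ereal (real (CARD('a) * B + 3))"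
    if "h \<in> inj_morphisms" for h :: "'a \<Rightarrow> 'b list"
    using that by (intro ACE_morph_inf_le) (auto simp: inj_morphisms_def)
  \<comment> \<open>With \<open>k = CARD('a)\<close>, the bound \<open>k * B + 3\<close> lies below
    the claimed one, since the latter also contains \<open>k * k * B\<close>, which is at least
    4.\<close>
  have "2 * 2 * 1 \<le> CARD('a) * CARD('a) * B"
    using assms(1) B(2) by (intro mult_le_mono) auto
  then have "CARD('a) * B + 3 \<le> CARD('a) + 1 + CARD('a) * (CARD('a) + 1) * B"
    by (simp add: algebra_simps)
  then have "real (CARD('a) * B + 3) \<le> real (CARD('a) + 1 + CARD('a) * (CARD('a) + 1) * B)"
    by (simp only: of_nat_le_iff)
  also have "\<dots> = real (CARD('a) + 1) + real (CARD('a) * (CARD('a) + 1)) * (of_int \<lfloor>x\<rfloor> + 1)"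
    by (simp only: of_nat_add of_nat_mult B(1))
  finally have "ACE_I TYPE('b) w \<le>
      ereal (real (CARD('a) + 1) + real (CARD('a) * (CARD('a) + 1)) * (of_int \<lfloor>x\<rfloor> + 1))"
    unfolding ACE_I_def by (intro SUP_least order_trans[OF le]) (simp_all only: ereal_less_eq)
  then show ?thesis using x(1) by simp
qed simp

end
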